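(* Let $\alpha\in(0,2)$, let $H_1,H_2,\ldots$ be i.i.d. random vectors in $\mathbb{R}^d$ whose common law has regularly varying tails with tail exponent $\alpha$, and let $(b_n)$ (positive reals) and $(c_n)$ (vectors in $\mathbb{R}^d$) be scaling and centering sequences such that $$b_n^{-1}\sum_{j=1}^n H_j-c_n\Longrightarrow \rho\quad (n\to\infty),$$ where $\rho$ is an $\alpha$-stable law on $\mathbb{R}^d$. Let $X_{nj}$, $1\le j\le n$, be the associated truncated observations with truncation levels $M_n>0$ (see context), and let $S_n=\sum_{j=1}^n X_{nj}$. If $\lim_{n\to\infty} nP(\|H_1\|>M_n)=0$ (soft truncation regime), then $$b_n^{-1}S_n-c_n\Longrightarrow\rho\quad (n\to\infty).$$
   Context: $\Longrightarrow$ denotes weak convergence (convergence in law); $\|\cdot\|$ is the Euclidean norm on $\mathbb{R}^d$, $d\ge1$. Regularly varying tails: let $\overline{\mathbb{R}^d}$ be the compactification of $\mathbb{R}^d$ obtained by adding a sphere of infinite radius centered at the origin. The law of a random vector $H_1$ has regularly varying tails with tail exponent $\alpha>0$ if there exist a sequence $a_n\uparrow\infty$ and a non-null Radon measure $\mu$ on $\overline{\mathbb{R}^d}\setminus\{0\}$ with $\mu(\overline{\mathbb{R}^d}\setminus\mathbb{R}^d)=0$ such that $nP(a_n^{-1}H_1\in\cdot)\to\mu(\cdot)$ vaguely on $\overline{\mathbb{R}^d}\setminus\{0\}$, where $\mu(cB)=c^{-\alpha}\mu(B)$ for all $c>0$ and Borel $B$. For $\alpha\in(0,2)$ such a law is in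 the domain of attraction of an $\alpha$-stable law. Truncated model: $R_1,R_2,\ldots$ are i.i.d. nonnegative random variables independent of $(H_j)$, $M_n>0$ are deterministic truncation levels, and $$X_{nj}=H_j\mathbf 1(\|H_j\|\le M_n)+\frac{H_j}{\|H_j\|}(M_n+R_j)\mathbf 1(\|H_j\|>M_n),\qquad j=1,\ldots,n,\ n\ge1.$$ *)

theory Defs
  imports "HOL-Probability.Probability"
begin

text \<open>The library's weak convergence is restricted to the real line, so convergence in law on
  a Euclidean space is defined by bounded continuous test functions.\<close>

definition weakly_converges :: "(nat \<Rightarrow> 'a::euclidean_space measure) \<Rightarrow> 'a measure \<Rightarrow> bool" where
  "weakly_converges \<nu> \<rho> \<longleftrightarrow>
     (\<forall>f :: 'a \<Rightarrow> real. continuous_on UNIV f \<and> bounded (range f) \<longrightarrow>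
        (\<lambda>n. \<integral>x. f x \<partial>\<nu> n) \<longlonglongrightarrow> (\<integral>x. f x \<partial>\<rho>))"

text \<open>The convolution form of stability with index \<open>\<alpha>\<close>: if \<open>X\<close>, \<open>Y\<close> are independent
  with law \<open>\<rho>\<close>, then \<open>A X + B Y\<close> has the law of \<open>(A powr \<alpha> + B powr \<alpha>) powr (1 / \<alpha>) X + D\<close> for some
  vector \<open>D\<close>. As is common in the multivariate theory (vanishing spectral measure), point masses
  are not excluded.\<close>

definition stable_law :: "real \<Rightarrow> 'a::euclidean_space measure \<Rightarrow> bool" where
  "stable_law \<alpha> \<rho> \<longleftrightarrow>
     0 < \<alpha> \<and> \<alpha> \<le> 2 \<and> prob_space \<rho> \<and> sets \<rho> = sets borel \<and>
     (\<forall>A>0. \<forall>B>0. \<exists>D.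
        distr (\<rho> \<Otimes>\<^sub>M \<rho>) borel (\<lambda>(x, y). A *\<^sub>R x + B *\<^sub>R y) =
        distr \<rho> borel (\<lambda>x. ((A powr \<alpha> + B powr \<alpha>) powr (1 / \<alpha>)) *\<^sub>R x + D))"

text \<open>The compactification of the space by a sphere of infinite radius, with the origin removed,
  in polar coordinates: a point is a radius in \<open>(0,\<infinity>]\<close> together with a direction in the unit
  sphere, under the product topology. The map \<open>polar\<close> embeds the nonzero vectors; it sends
  the origin to \<open>(0, 0)\<close>, which lies outside \<open>punctured_cpt\<close>.\<close>

definition punctured_cpt :: "(ereal \<times> 'a::euclidean_space) set" where
  "punctured_cpt = {0<..} \<times> sphere 0 1"

definition sphere_at_infinity :: "(ereal \<times> 'a::euclidean_space) set" where
  "sphere_at_infinity = {\<infinity>} \<times> sphere 0 1"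

definition polar :: "'a::euclidean_space \<Rightarrow> ereal \<times> 'a" where
  "polar x = (ereal (norm x), sgn x)"

text \<open>Multiplication by \<open>c > 0\<close>; it fixes the sphere at infinity.\<close>

definition dilate :: "real \<Rightarrow> ereal \<times> 'a::euclidean_space \<Rightarrow> ereal \<times> 'a" where
  "dilate c = (\<lambda>(r, \<theta>). (ereal c * r, \<theta>))"

text \<open>On a locally compact space with a countable base, such as \<open>punctured_cpt\<close>, a Borel
  measure that is finite on compact sets is automatically regular, hence Radon.\<close>

definition radon_on :: "'b::topological_space set \<Rightarrow> 'b measure \<Rightarrow> bool" where
  "radon_on E \<mu> \<longleftrightarrow>
     sets \<mu> = sets (restrict_space borel E) \<and>
     (\<forall>K. compact K \<and> K \<subseteq> E \<longrightarrow> emeasure \<mu> K < \<infinity>)"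

definition vaguely_converges_on ::
    "'b::topological_space set \<Rightarrow> (nat \<Rightarrow> 'b measure) \<Rightarrow> 'b measure \<Rightarrow> bool" where
  "vaguely_converges_on E \<nu> \<mu> \<longleftrightarrow>
     (\<forall>f :: 'b \<Rightarrow> real.
        continuous_on E f \<and> (\<exists>K. compact K \<and> K \<subseteq> E \<and> (\<forall>x\<in>E - K. f x = 0)) \<longrightarrow>
        (\<lambda>n. \<integral>x. f x \<partial>\<nu> n) \<longlonglongrightarrow> (\<integral>x. f x \<partial>\<mu>))"

text \<open>The measure \<open>n P(H / a \<in> \<cdot>)\<close> on the punctured compactification, \<open>\<nu>\<close> being the law
  of \<open>H\<close>.\<close>

definition tail_measure :: "'a::euclidean_space measure \<Rightarrow> nat \<Rightarrow> real \<Rightarrow> (ereal \<times> 'a) measure" where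
  "tail_measure \<nu> n a =
     scale_measure (of_nat n)
       (restrict_space (distr \<nu> borel (\<lambda>x. polar (x /\<^sub>R a))) punctured_cpt)"

definition regularly_varying_tails :: "real \<Rightarrow> 'a::euclidean_space measure \<Rightarrow> bool" where
  "regularly_varying_tails \<alpha> \<nu> \<longleftrightarrow>
     0 < \<alpha> \<and>
     (\<exists>(a :: nat \<Rightarrow> real) \<mu>.
        (\<forall>n. 0 < a n) \<and> incseq a \<and> filterlim a at_top sequentially \<and>
        radon_on punctured_cpt \<mu> \<and>
        emeasure \<mu> (space \<mu>) \<noteq> 0 \<and>
        emeasure \<mu> sphere_at_infinity = 0 \<and>
        vaguely_converges_on punctured_cpt (\<lambda>n. tail_measure \<nu> n (a n)) \<mu> \<and>
        (\<forall>c>0. \<forall>B\<in>sets \<mu>.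
           emeasure \<mu> (dilate c ` B) = ennreal (c powr (-\<alpha>)) * emeasure \<mu> B))"

definition iid_vars ::
    "'w measure \<Rightarrow> 'i set \<Rightarrow> ('i \<Rightarrow> 'w \<Rightarrow> 'a::topological_space) \<Rightarrow> bool" where
  "iid_vars P I X \<longleftrightarrow>
     prob_space.indep_vars P (\<lambda>_. borel) X I \<and>
     (\<forall>i\<in>I. \<forall>j\<in>I. distr P borel (X i) = distr P borel (X j))"

text \<open>Independence of two whole sequences: the sigma-algebras they generate are independent.
  The library's \<open>indep_var\<close> requires both sides to have the same value type.\<close>

definition generated_events ::
    "'w measure \<Rightarrow> 'i set \<Rightarrow> ('i \<Rightarrow> 'w \<Rightarrow> 'a::topological_space) \<Rightarrow> 'w set set" where
  "generated_events P I X =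
     sets (vimage_algebra (space P) (\<lambda>\<omega>. \<lambda>i\<in>I. X i \<omega>) (\<Pi>\<^sub>M i\<in>I. borel))"

definition indep_sequences ::
    "'w measure \<Rightarrow> 'i set \<Rightarrow> ('i \<Rightarrow> 'w \<Rightarrow> 'a::topological_space) \<Rightarrow>
     ('i \<Rightarrow> 'w \<Rightarrow> 'b::topological_space) \<Rightarrow> bool" where
  "indep_sequences P I X Y \<longleftrightarrow>
     prob_space.indep_set P (generated_events P I X) (generated_events P I Y)"

definition truncated :: "real \<Rightarrow> real \<Rightarrow> 'a::euclidean_space \<Rightarrow> 'a" where
  "truncated m r h =
     of_bool (norm h \<le> m) *\<^sub>R h + (of_bool (norm h > m) * (m + r)) *\<^sub>R (h /\<^sub>R norm h)"

end

theory Submission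
  imports Defs
begin

text \<open>On the event that no \<open>H\<^sub>j\<close> with \<open>j \<le> n\<close> exceeds the truncation level, the truncated and the
  original sums coincide. By the union bound the complementary event has probability at most
  \<open>n P(\<parallel>H\<^sub>1\<parallel> > M\<^sub>n) \<rightarrow> 0\<close>, and changing a random vector on an event of vanishing probability
  does not affect its limit in law.\<close>

text \<open>A test function bounded by \<open>B\<close> has integrals under the two laws that differ
  only through \<open>A n\<close>, hence by at most \<open>2 * B * prob (A n)\<close>, which
  vanishes. The hypotheses are only eventual because quantities at index 0 may be
  unspecified.\<close>

lemma weakly_converges_distr_cong:
  fixes U V :: "nat \<Rightarrow> 'w \<Rightarrow> 'a::euclidean_space"
  assumes "prob_space P"
    and U: "\<forall>\<^sub>F n in sequentially. U n \<in> borel_measurable P"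
    and V: "\<forall>\<^sub>F n in sequentially. V n \<in> borel_measurable P"
    and A: "\<forall>\<^sub>F n in sequentially. A n \<in> sets P"
    and eq: "\<forall>\<^sub>F n in sequentially. \<forall>\<omega>\<in>space P - A n. U n \<omega> = V n \<omega>"
    and lim: "(\<lambda>n. measure P (A n)) \<longlonglongrightarrow> 0"
    and conv: "weakly_converges (\<lambda>n. distr P borel (V n)) \<rho>"
  shows "weakly_converges (\<lambda>n. distr P borel (U n)) \<rho>"
  unfolding weakly_converges_def
proof (intro allI impI)
  interpret prob_space P by fact
  fix f :: "'a \<Rightarrow> real"
  assume f: "continuous_on UNIV f \<and> bounded (range f)"
  then obtain B where B: "\<And>x. \<bar>f x\<bar> \<le> B"
    by (auto simp: bounded_iff)
  have [measurable]: "f \<in> borel_measurable borel"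
    using f by (simp add: borel_measurable_continuous_onI)
  have bound: "\<forall>\<^sub>F n in sequentially.
    norm ((\<integral>x. f x \<partial>distr P borel (U n)) - (\<integral>x. f x \<partial>distr P borel (V n))) \<le> 2 * B * prob (A n)"
    using U V A eq
  proof eventually_elim
    case (elim n)
    note [measurable] = elim(1-3)
    have int: "integrable P (\<lambda>\<omega>. f (U n \<omega>))" "integrable P (\<lambda>\<omega>. f (V n \<omega>))"
      by (rule integrable_const_bound[where B = B]; simp add: B)+
    \<comment> \<open>Off \<open>A n\<close> the integrand is 0; on \<open>A n\<close> the triangle
      inequality gives \<open>2 * B\<close>.\<close>
    have "norm (\<integral>\<omega>. f (U n \<omega>) - f (V n \<omega>) \<partial>P) \<le> (\<integral>\<omega>. 2 * B * indicator (A n) \<omega> \<partial>P)"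
    proof (rule order_trans[OF integral_norm_bound integral_mono])
      fix \<omega> assume "\<omega> \<in> space P"
      then show "norm (f (U n \<omega>) - f (V n \<omega>)) \<le> 2 * B * indicator (A n) \<omega>"
        using elim(4) B[of "U n \<omega>"] B[of "V n \<omega>"] by (auto simp: indicator_def)
    qed (use int in \<open>auto simp: less_top[symmetric]\<close>)
    then show ?case
      using int by (simp add: integral_distr)
  qed
  have "(\<lambda>n. (\<integral>x. f x \<partial>distr P borel (U n)) - (\<integral>x. f x \<partial>distr P borel (V n))) \<longlonglongrightarrow> 0"
    by (rule Lim_null_comparison[OF bound]) (use tendsto_mult_right_zero[OF lim] in simp)
  moreover have "(\<lambda>n. \<integral>x. f x \<partial>distr P borel (V n)) \<longlonglongrightarrow> (\<integral>x. f x \<partial>\<rho>)"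
    using conv f by (simp add: weakly_converges_def)
  ultimately show "(\<lambda>n. \<integral>x. f x \<partial>distr P borel (U n)) \<longlonglongrightarrow> (\<integral>x. f x \<partial>\<rho>)"
    by (rule Lim_transform[rotated])
qed

lemma borel_measurable_truncated [measurable (raw)]:
  fixes h :: "'w \<Rightarrow> 'a::euclidean_space"
  assumes [measurable]: "r \<in> borel_measurable N" "h \<in> borel_measurable N"
  shows "(\<lambda>\<omega>. truncated m (r \<omega>) (h \<omega>)) \<in> borel_measurable N"
  \<comment> \<open>The direction \<open>h /\<^sub>R norm h\<close> takes the value 0 at the origin,
    since \<open>inverse 0 = 0\<close>, so it is Borel on the whole space.\<close>
  unfolding truncated_def of_bool_def by measurable

lemma truncated_eq_self: "norm h \<le> m \<Longrightarrow> truncated m r h = h"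
  unfolding truncated_def by simp

lemma iid_vars_measurable:
  assumes "prob_space P" "iid_vars P I X" "i \<in> I"
  shows "X i \<in> borel_measurable P"
  using assms by (auto simp: iid_vars_def prob_space.indep_vars_def)

lemma iid_vars_prob_eq:
  assumes "prob_space P" "iid_vars P I X" "i \<in> I" "j \<in> I" "B \<in> sets borel"
  shows "\<P>(\<omega> in P. X i \<omega> \<in> B) = \<P>(\<omega> in P. X j \<omega> \<in> B)"
proof -
  interpret prob_space P by fact
  have *: "\<P>(\<omega> in P. X k \<omega> \<in> B) = measure (distr P borel (X k)) B" if "k \<in> I" for k
    unfolding measure_distr[OF iid_vars_measurable[OF assms(1,2) that] assms(5)]
    by (rule arg_cong[where f = prob]) blast
  have "distr P borel (X i) = distr P borel (X j)"
    using assms(2-4) unfolding iid_vars_def by blast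
  then show ?thesis
    by (simp only: *[OF assms(3)] *[OF assms(4)])
qed

theorem theorem2p1:
  fixes P :: "'w measure"
    and H :: "nat \<Rightarrow> 'w \<Rightarrow> 'a::euclidean_space"
    and R :: "nat \<Rightarrow> 'w \<Rightarrow> real"
    and M b :: "nat \<Rightarrow> real"
    and c :: "nat \<Rightarrow> 'a"
    and X :: "nat \<Rightarrow> nat \<Rightarrow> 'w \<Rightarrow> 'a"
    and S :: "nat \<Rightarrow> 'w \<Rightarrow> 'a"
    and \<rho> :: "'a measure"
    and \<alpha> :: real
  assumes "prob_space P"
    and "0 < \<alpha>" and "\<alpha> < 2"
    and "iid_vars P {1..} H"
    and "regularly_varying_tails \<alpha> (distr P borel (H 1))"
    and "iid_vars P {1..} R"
    and "\<And>j. j \<ge> 1 \<Longrightarrow> AE \<omega> in P. 0 \<le> R j \<omega>"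
    and "indep_sequences P {1..} H R"
    and "\<And>n. n \<ge> 1 \<Longrightarrow> 0 < M n"
    and "\<And>n. n \<ge> 1 \<Longrightarrow> 0 < b n"
    and "stable_law \<alpha> \<rho>"
    and "weakly_converges
           (\<lambda>n. distr P borel (\<lambda>\<omega>. (\<Sum>j=1..n. H j \<omega>) /\<^sub>R b n - c n)) \<rho>"
    and "\<And>n j \<omega>. 1 \<le> j \<Longrightarrow> j \<le> n \<Longrightarrow> \<omega> \<in> space P \<Longrightarrow> X n j \<omega> = truncated (M n) (R j \<omega>) (H j \<omega>)"
    and "\<And>n \<omega>. n \<ge> 1 \<Longrightarrow> \<omega> \<in> space P \<Longrightarrow> S n \<omega> = (\<Sum>j=1..n. X n j \<omega>)"
    and "(\<lambda>n. real n * \<P>(\<omega> in P. norm (H 1 \<omega>) > M n)) \<longlonglongrightarrow> 0"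
  shows "weakly_converges (\<lambda>n. distr P borel (\<lambda>\<omega>. S n \<omega> /\<^sub>R b n - c n)) \<rho>"
proof -
  interpret prob_space P by fact
  have H [measurable]: "H j \<in> borel_measurable P" if "j \<ge> 1" for j
    using iid_vars_measurable[OF assms(1,4)] that by simp
  have R [measurable]: "R j \<in> borel_measurable P" if "j \<ge> 1" for j
    using iid_vars_measurable[OF assms(1,6)] that by simp
  define E where "E n j = {\<omega> \<in> space P. norm (H j \<omega>) > M n}" for n j
  have E [measurable]: "E n j \<in> sets P" if "j \<ge> 1" for n j
    using H[OF that] unfolding E_def by measurable
  \<comment> \<open>Identical distribution reduces every exceedance probability to that of
    \<open>H 1\<close>, the one controlled by the soft truncation hypothesis.\<close>
  have prob_E: "prob (E n j) = prob (E n 1)" if "j \<ge> 1" for n j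
    using iid_vars_prob_eq[OF assms(1,4), of j 1 "{x. norm x > M n}"] that
    by (simp add: E_def)
  \<comment> \<open>The exceptional event: some observation among the first \<open>n\<close> exceeds
    \<open>M n\<close>. For \<open>n = 0\<close> it is empty, so the union bound below holds for
    every \<open>n\<close>.\<close>
  define A where "A n = (\<Union>j\<in>{1..n}. E n j)" for n
  have A: "A n \<in> sets P" for n
    unfolding A_def by (intro sets.finite_UN) auto
  \<comment> \<open>\<open>S n\<close> is prescribed only for \<open>n \<ge> 1\<close> and on
    \<open>space P\<close>; this restriction is why later claims about \<open>S\<close> are made
    eventually in \<open>n\<close>.\<close>
  have S_eq: "S n \<omega> = (\<Sum>j=1..n. truncated (M n) (R j \<omega>) (H j \<omega>))"
    if "n \<ge> 1" "\<omega> \<in> space P" for n \<omega>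
    using assms(13,14) that by simp
  have lim: "(\<lambda>n. prob (A n)) \<longlonglongrightarrow> 0"
  proof (rule tendsto_sandwich[OF _ _ tendsto_const])
    show "\<forall>\<^sub>F n in sequentially. prob (A n) \<le> real n * prob (E n 1)"
    proof (intro always_eventually allI)
      fix n
      have "prob (A n) \<le> (\<Sum>j=1..n. prob (E n j))"
        unfolding A_def by (intro finite_measure_subadditive_finite) auto
      also have "\<dots> = (\<Sum>j=1..n. prob (E n 1))"
        by (intro sum.cong refl prob_E) simp
      also have "\<dots> = real n * prob (E n 1)"
        by simp
      finally show "prob (A n) \<le> real n * prob (E n 1)" .
    qed
    show "(\<lambda>n. real n * prob (E n 1)) \<longlonglongrightarrow> 0"
      using assms(15) by (simp add: E_def)
  qed auto
  show ?thesis
  proof (rule weakly_converges_distr_cong[OF assms(1) _ _ _ _ lim assms(12)])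
    show "\<forall>\<^sub>F n in sequentially. (\<lambda>\<omega>. S n \<omega> /\<^sub>R b n - c n) \<in> borel_measurable P"
      using eventually_ge_at_top[of 1]
    proof eventually_elim
      case (elim n)
      \<comment> \<open>Measurability is shown for the explicit sum and then transferred to
        \<open>S n\<close>, which agrees with it on \<open>space P\<close>.\<close>
      have "(\<lambda>\<omega>. (\<Sum>j=1..n. truncated (M n) (R j \<omega>) (H j \<omega>)) /\<^sub>R b n - c n) \<in> borel_measurable P"
        by (intro borel_measurable_diff borel_measurable_scaleR borel_measurable_const
            borel_measurable_sum borel_measurable_truncated) auto
      then show ?case
        using elim S_eq by (simp cong: measurable_cong)
    qed
    show "\<forall>\<^sub>F n in sequentially. (\<lambda>\<omega>. (\<Sum>j=1..n. H j \<omega>) /\<^sub>R b n - c n) \<in> borel_measurable P"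
      by (intro always_eventually allI borel_measurable_diff borel_measurable_scaleR
          borel_measurable_const borel_measurable_sum) auto
    show "\<forall>\<^sub>F n in sequentially. A n \<in> sets P"
      using A by simp
    show "\<forall>\<^sub>F n in sequentially. \<forall>\<omega>\<in>space P - A n.
        S n \<omega> /\<^sub>R b n - c n = (\<Sum>j=1..n. H j \<omega>) /\<^sub>R b n - c n"
      using eventually_ge_at_top[of 1]
    proof eventually_elim
      case (elim n)
      \<comment> \<open>Outside \<open>A n\<close> every \<open>norm (H j \<omega>)\<close> with
        \<open>1 \<le> j \<le> n\<close> is at most \<open>M n\<close>, so truncation leaves each
        summand unchanged, whatever the value of \<open>R j \<omega>\<close>.\<close>
      have "(\<Sum>j=1..n. truncated (M n) (R j \<omega>) (H j \<omega>)) = (\<Sum>j=1..n. H j \<omega>)"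
        if "\<omega> \<in> space P - A n" for \<omega>
        using that by (intro sum.cong refl truncated_eq_self) (auto simp: A_def E_def not_less)
      then show ?case
        using elim S_eq by simp
    qed
  qed
qed

end
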